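(* Let $P(n)$ denote the number of prefix normal binary words of length $n$. Then $P(n)=2^{n-\Theta((\log n)^2)}$ as $n\to\infty$; that is, there exist constants $0<c_1\le c_2$ such that for all sufficiently large $n$, $2^{n-c_2(\log n)^2}\le P(n)\le 2^{n-c_1(\log n)^2}$.
   Context: For a binary word $w=w_1w_2\dots w_n\in\{0,1\}^n$ and $1\le j\le k\le n$, let $w[j,k]=w_jw_{j+1}\dots w_k$, and let $|u|_1$ denote the number of 1s in a binary word $u$ (with $|w[1,0]|_1=0$). The word $w$ is called prefix normal if for every $0\le k\le n$ and every $0\le j\le n-k$ we have $|w[1,k]|_1\ge |w[j+1,j+k]|_1$, i.e. no subword of length $k$ contains more 1s than the prefix of length $k$. *)

theory Defs
  imports Complex_Main
begin

(* Binary words are Boolean lists, with True for the letter 1 and False for 0. *)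
type_synonym word = "bool list"

definition ones :: "word \<Rightarrow> nat" where
  "ones u = count_list u True"

(* subword w j k is w[j,k] with 1-based inclusive positions, meant for j \<ge> 1;
   it is empty if k < j. *)
definition subword :: "word \<Rightarrow> nat \<Rightarrow> nat \<Rightarrow> word" where
  "subword w j k = take (k + 1 - j) (drop (j - 1) w)"

definition prefix_normal :: "word \<Rightarrow> bool" where
  "prefix_normal w \<longleftrightarrow>
     (\<forall>k \<le> length w. \<forall>j \<le> length w - k. ones (subword w (j + 1) (j + k)) \<le> ones (subword w 1 k))"

definition num_prefix_normal :: "nat \<Rightarrow> nat" where
  "num_prefix_normal n = card {w :: word. length w = n \<and> prefix_normal w}"

end

theory Submission
  imports Defs "HOL-Probability.Hoeffding" "HOL-Real_Asymp.Real_Asymp"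
begin

text \<open>
  Lower bound: let the letters be independent, letter \<open>i\<close> having expected sign of order
  \<open>sqrt (ln n / i)\<close>. Then the expected balance \<open>C * sqrt (k * ln n)\<close> of a prefix
  is strongly concave in \<open>k\<close>, so such a word is prefix normal with probability at least \<open>1/2\<close>, and
  since the sum of the squared biases is \<open>O((ln n)^2)\<close>, Cauchy--Schwarz turns this into a lower bound
  for the number of prefix normal words.

  Upper bound: among the \<open>n / k\<close> disjoint blocks of length \<open>k \<le> sqrt n\<close> of a typical word, some block
  has balance at least \<open>sqrt (k * ln n) / 4\<close>. A prefix normal word must therefore, up to a negligible
  number of exceptions, have that prefix balance for all \<open>k\<close> from \<open>n^(1/4)\<close> to \<open>sqrt n\<close>. Testing these
  conditions simultaneously against weights of order \<open>sqrt (ln n / i)\<close>, a Chernoff bound shows that they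
  have probability \<open>exp (- c * (ln n)^2)\<close>.
\<close>

section \<open>Biased product measures on words\<close>

definition words :: "nat \<Rightarrow> word set" where
  "words n = {w. length w = n}"

definition letter_sign :: "bool \<Rightarrow> real" where
  "letter_sign b = (if b then 1 else -1)"

text \<open>Twice the number of ones minus the length, over the (0-based) positions in \<open>I\<close>.\<close>

definition balance :: "word \<Rightarrow> nat set \<Rightarrow> real" where
  "balance w I = (\<Sum>i\<in>I. letter_sign (w ! i))"

text \<open>The probability of \<open>w\<close> when the letters are independent and letter \<open>i\<close> has mean sign \<open>m i\<close>.\<close>

definition word_prob :: "(nat \<Rightarrow> real) \<Rightarrow> word \<Rightarrow> real" where
  "word_prob m w = (\<Prod>i<length w. (1 + m i * letter_sign (w ! i)) / 2)"

lemma finite_words [simp]: "finite (words n)"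
  using finite_lists_length_eq[of "UNIV :: bool set" n] by (simp add: words_def)

lemma card_words: "card (words n) = 2 ^ n"
  using card_lists_length_eq[of "UNIV :: bool set" n] by (simp add: words_def)

lemma words_Suc: "words (Suc n) = (\<lambda>(b, w). b # w) ` (UNIV \<times> words n)"
  by (force simp: words_def length_Suc_conv)

lemma abs_letter_sign [simp]: "\<bar>letter_sign b\<bar> = 1"
  by (simp add: letter_sign_def)

text \<open>Independence of the letters in finite form; every expectation below is evaluated through
  it. The induction splits off the first letter, which shifts the factors \<open>g\<close>, so
  \<open>g\<close> is generalised.\<close>

lemma sum_words_prod:
  "(\<Sum>w\<in>words n. \<Prod>i<n. g i (w ! i)) = (\<Prod>i<n. g i True + g i False :: real)"
proof (induction n arbitrary: g)
  case 0
  then show ?case by (simp add: words_def)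
next
  case (Suc n)
  have "(\<Sum>w\<in>words (Suc n). \<Prod>i<Suc n. g i (w ! i)) =
      (\<Sum>(b, w)\<in>UNIV \<times> words n. g 0 b * (\<Prod>i<n. g (Suc i) (w ! i)))"
    unfolding words_Suc
    by (subst sum.reindex) (auto simp: inj_on_def prod.lessThan_Suc_shift o_def split_def
        simp del: prod.lessThan_Suc)
  also have "\<dots> = (\<Sum>b\<in>UNIV. g 0 b) * (\<Sum>w\<in>words n. \<Prod>i<n. g (Suc i) (w ! i))"
    by (simp add: sum.cartesian_product [symmetric] sum_product)
  also have "\<dots> = (g 0 True + g 0 False) * (\<Prod>i<n. g (Suc i) True + g (Suc i) False)"
    using Suc.IH[of "\<lambda>i. g (Suc i)"] by (simp add: UNIV_bool add.commute)
  finally show ?case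
    by (simp add: prod.lessThan_Suc_shift del: prod.lessThan_Suc)
qed

lemma word_prob_nonneg:
  assumes "\<And>i. \<bar>m i\<bar> \<le> 1"
  shows "0 \<le> word_prob m w"
  unfolding word_prob_def
proof (intro prod_nonneg ballI)
  fix i
  have "- m i \<le> 1" "m i \<le> 1" using assms[of i] by linarith+
  then show "0 \<le> (1 + m i * letter_sign (w ! i)) / 2" by (simp add: letter_sign_def)
qed

lemma word_prob_zero: "word_prob (\<lambda>_. 0) w = 1 / 2 ^ length w"
  by (simp add: word_prob_def power_one_over)

lemma sum_word_prob: "(\<Sum>w\<in>words n. word_prob m w) = 1"
proof -
  have "(\<Sum>w\<in>words n. word_prob m w) =
      (\<Sum>w\<in>words n. \<Prod>i<n. (1 + m i * letter_sign (w ! i)) / 2)"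
    by (rule sum.cong) (auto simp: words_def word_prob_def)
  also have "\<dots> = 1"
    by (subst sum_words_prod[of "\<lambda>i b. (1 + m i * letter_sign b) / 2"])
      (simp add: letter_sign_def add_divide_distrib [symmetric])
  finally show ?thesis .
qed

text \<open>At each position the terms linear in \<open>m i\<close> cancel between the two letters
  and only the squared bias survives. This is the second moment that Cauchy--Schwarz needs.\<close>

lemma sum_word_prob_squared:
  "(\<Sum>w\<in>words n. (word_prob m w)\<^sup>2) = (\<Prod>i<n. 1 + (m i)\<^sup>2) / 2 ^ n"
proof -
  have "(\<Sum>w\<in>words n. (word_prob m w)\<^sup>2) =
      (\<Sum>w\<in>words n. \<Prod>i<n. ((1 + m i * letter_sign (w ! i)) / 2)\<^sup>2)"
    by (rule sum.cong) (auto simp: words_def word_prob_def prod_power_distrib)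
  also have "\<dots> = (\<Prod>i<n. (1 + (m i)\<^sup>2) / 2)"
    by (subst sum_words_prod[of "\<lambda>i b. ((1 + m i * letter_sign b) / 2)\<^sup>2"])
      (intro prod.cong, auto simp: letter_sign_def power2_eq_square field_simps)
  also have "\<dots> = (\<Prod>i<n. 1 + (m i)\<^sup>2) / 2 ^ n"
    by (simp add: prod_dividef)
  finally show ?thesis .
qed

text \<open>Cauchy--Schwarz for the density of the biased measure with respect to the uniform one.\<close>

lemma card_ge_word_prob_squared:
  assumes "A \<subseteq> words n"
  shows "2 ^ n * (\<Sum>w\<in>A. word_prob m w)\<^sup>2 * exp (- (\<Sum>i<n. (m i)\<^sup>2)) \<le> real (card A)"
proof -
  have "(\<Sum>w\<in>A. word_prob m w)\<^sup>2 = (\<Sum>w\<in>A. 1 * word_prob m w)\<^sup>2" by simp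
  also have "\<dots> \<le> (\<Sum>w\<in>A. 1\<^sup>2) * (\<Sum>w\<in>A. (word_prob m w)\<^sup>2)"
    by (rule Cauchy_Schwarz_ineq_sum)
  also have "\<dots> \<le> card A * (\<Sum>w\<in>words n. (word_prob m w)\<^sup>2)"
    using assms by (auto intro!: mult_left_mono sum_mono2)
  also have "\<dots> = card A * ((\<Prod>i<n. 1 + (m i)\<^sup>2) / 2 ^ n)"
    by (simp add: sum_word_prob_squared)
  also have "\<dots> \<le> card A * (exp (\<Sum>i<n. (m i)\<^sup>2) / 2 ^ n)"
    unfolding exp_sum[OF finite_lessThan]
    by (intro mult_left_mono divide_right_mono prod_mono) auto
  finally show ?thesis
    by (simp add: exp_minus field_simps)
qed

section \<open>Exponential moments and the Chernoff bound\<close>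

text \<open>Hoeffding's lemma for a random sign of mean \<open>m\<close>. Such a sign has range of
  width 2, whence the argument \<open>2 * l\<close> in the Bernoulli form with parameter
  \<open>p\<close>; negative \<open>l\<close> follows by flipping the sign.\<close>

lemma biased_exp_le:
  fixes m l :: real
  assumes "\<bar>m\<bar> \<le> 1"
  shows "(1 + m) / 2 * exp l + (1 - m) / 2 * exp (- l) \<le> exp (l * m + l\<^sup>2 / 2)"
proof -
  have *: "(1 + m) / 2 * exp l + (1 - m) / 2 * exp (- l) \<le> exp (l * m + l\<^sup>2 / 2)"
    if "\<bar>m\<bar> \<le> 1" "0 \<le> l" for m l :: real
  proof -
    define p where "p = (1 + m) / 2"
    have p: "0 \<le> p" using that by (simp add: p_def abs_le_iff)
    have pos: "0 < 1 + p * (exp (2 * l) - 1)"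
      using p that by (intro add_pos_nonneg mult_nonneg_nonneg) auto
    have "- (2 * l) * p + ln (1 + p * (exp (2 * l) - 1)) \<le> (2 * l)\<^sup>2 / 8"
      using Hoeffdings_lemma_aux[of "2 * l" p] p that by simp
    then have "ln (1 + p * (exp (2 * l) - 1)) \<le> 2 * l * p + l\<^sup>2 / 2"
      by (simp add: power2_eq_square)
    then have le: "1 + p * (exp (2 * l) - 1) \<le> exp (2 * l * p + l\<^sup>2 / 2)"
      using pos by (metis exp_le_cancel_iff exp_ln)
    have e: "exp l = exp (- l) * exp (2 * l)"
      by (simp flip: exp_add)
    have "(1 + m) / 2 * exp l + (1 - m) / 2 * exp (- l) = p * exp l + (1 - p) * exp (- l)"
      by (simp add: p_def field_simps)
    also have "\<dots> = exp (- l) * (1 + p * (exp (2 * l) - 1))"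
      unfolding e by (simp add: algebra_simps)
    also have "\<dots> \<le> exp (- l) * exp (2 * l * p + l\<^sup>2 / 2)"
      using le by simp
    also have "\<dots> = exp (l * m + l\<^sup>2 / 2)"
      by (simp add: p_def algebra_simps add_divide_distrib flip: exp_add)
    finally show ?thesis .
  qed
  show ?thesis
  proof (cases "0 \<le> l")
    case True
    then show ?thesis using * assms by blast
  next
    case False
    then show ?thesis using *[of "- m" "- l"] assms by (simp add: add.commute)
  qed
qed

text \<open>Exponential Markov inequality followed by the moment bound letter by letter. The weights
  \<open>l i\<close> may have any sign, so one statement serves both tails and comparisons of two
  factors.\<close>

lemma chernoff_words:
  assumes m: "\<And>i. \<bar>m i\<bar> \<le> 1"
    and A: "A \<subseteq> words n" "\<And>w. w \<in> A \<Longrightarrow> t \<le> (\<Sum>i<n. l i * letter_sign (w ! i))"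
  shows "(\<Sum>w\<in>A. word_prob m w) \<le> exp ((\<Sum>i<n. l i * m i) + (\<Sum>i<n. (l i)\<^sup>2) / 2 - t)"
proof -
  let ?f = "\<lambda>w. \<Sum>i<n. l i * letter_sign (w ! i)"
  have "(\<Sum>w\<in>A. word_prob m w) \<le> (\<Sum>w\<in>A. word_prob m w * exp (?f w - t))"
  proof (rule sum_mono)
    fix w assume "w \<in> A"
    then have "1 \<le> exp (?f w - t)" using A(2) by simp
    then show "word_prob m w \<le> word_prob m w * exp (?f w - t)"
      using word_prob_nonneg[of m w] m by (simp add: mult_le_cancel_left1)
  qed
  also have "\<dots> \<le> (\<Sum>w\<in>words n. word_prob m w * exp (?f w - t))"
    using A(1) word_prob_nonneg m by (intro sum_mono2) auto
  also have "\<dots> = exp (- t) * (\<Sum>w\<in>words n. \<Prod>i<n.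
      (1 + m i * letter_sign (w ! i)) / 2 * exp (l i * letter_sign (w ! i)))"
    unfolding sum_distrib_left
  proof (rule sum.cong)
    fix w assume w: "w \<in> words n"
    have "exp (?f w - t) = exp (- t) * (\<Prod>i<n. exp (l i * letter_sign (w ! i)))"
      by (simp add: exp_diff exp_minus exp_sum divide_inverse mult.commute)
    then show "word_prob m w * exp (?f w - t) = exp (- t) * (\<Prod>i<n.
        (1 + m i * letter_sign (w ! i)) / 2 * exp (l i * letter_sign (w ! i)))"
      using w by (simp only: prod.distrib) (simp add: words_def word_prob_def)
  qed simp
  also have "\<dots> = exp (- t) * (\<Prod>i<n. (1 + m i) / 2 * exp (l i) + (1 - m i) / 2 * exp (- l i))"
    by (subst sum_words_prod[of "\<lambda>i b. (1 + m i * letter_sign b) / 2 * exp (l i * letter_sign b)"])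
      (simp add: letter_sign_def)
  also have "\<dots> \<le> exp (- t) * (\<Prod>i<n. exp (l i * m i + (l i)\<^sup>2 / 2))"
  proof (intro mult_left_mono prod_mono conjI)
    fix i
    have "- m i \<le> 1" "m i \<le> 1" using m[of i] by linarith+
    then show "0 \<le> (1 + m i) / 2 * exp (l i) + (1 - m i) / 2 * exp (- l i)"
      by (intro add_nonneg_nonneg mult_nonneg_nonneg) auto
    show "(1 + m i) / 2 * exp (l i) + (1 - m i) / 2 * exp (- l i) \<le> exp (l i * m i + (l i)\<^sup>2 / 2)"
      by (rule biased_exp_le[OF m])
  qed simp
  also have "\<dots> = exp ((\<Sum>i<n. l i * m i) + (\<Sum>i<n. (l i)\<^sup>2) / 2 - t)"
    by (simp add: exp_sum [symmetric] exp_add [symmetric] sum.distrib sum_divide_distrib)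
  finally show ?thesis .
qed

section \<open>Prefix normality in terms of balances\<close>

lemma ones_eq_balance: "2 * real (ones u) = real (length u) + balance u {..<length u}"
proof (induction u)
  case Nil
  then show ?case by (simp add: ones_def balance_def)
next
  case (Cons b u)
  then show ?case
    by (simp add: ones_def balance_def letter_sign_def sum.lessThan_Suc_shift del: sum.lessThan_Suc)
qed

lemma balance_take_drop:
  assumes "j + k \<le> length w"
  shows "balance (take k (drop j w)) {..<k} = balance w {j..<j + k}"
proof -
  have "balance (take k (drop j w)) {..<k} = (\<Sum>i<k. letter_sign (w ! (j + i)))"
    using assms by (simp add: balance_def)
  also have "\<dots> = balance w {j..<j + k}"
    unfolding balance_def using sum.shift_bounds_nat_ivl[of "\<lambda>i. letter_sign (w ! i)" 0 j k]
    by (simp add: lessThan_atLeast0 add.commute)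
  finally show ?thesis .
qed

lemma ones_subword:
  assumes "j + k \<le> length w"
  shows "2 * real (ones (subword w (j + 1) (j + k))) = real k + balance w {j..<j + k}"
  using ones_eq_balance[of "take k (drop j w)"] balance_take_drop[OF assms] assms
  by (simp add: subword_def)

text \<open>Factors of equal length have the same constant term in the relation between ones and
  balance, so comparing ones is comparing balances.\<close>

lemma prefix_normal_iff_balance:
  "prefix_normal w \<longleftrightarrow>
    (\<forall>j k. j + k \<le> length w \<longrightarrow> balance w {j..<j + k} \<le> balance w {..<k})"
proof -
  have "ones (subword w (j + 1) (j + k)) \<le> ones (subword w 1 k) \<longleftrightarrow>
      balance w {j..<j + k} \<le> balance w {..<k}" if "j + k \<le> length w" for j k
    using ones_subword[OF that] ones_subword[of 0 k w] that
    by (simp add: lessThan_atLeast0) linarith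
  moreover have "k \<le> length w \<and> j \<le> length w - k \<longleftrightarrow> j + k \<le> length w" for j k
    by auto
  ultimately show ?thesis unfolding prefix_normal_def by blast
qed

lemma balance_disjoint_union:
  assumes "finite I" "finite J" "I \<inter> J = {}"
  shows "balance w (I \<union> J) = balance w I + balance w J"
  using assms by (simp add: balance_def sum.union_disjoint)

text \<open>Removing the common letters of two overlapping factors leaves two disjoint ones.\<close>

lemma not_prefix_normalD:
  assumes "\<not> prefix_normal w"
  obtains j k where "0 < j" "j \<le> k" "k + j \<le> length w" "balance w {..<j} < balance w {k..<k + j}"
proof -
  obtain d k where dk: "d + k \<le> length w" "balance w {..<k} < balance w {d..<d + k}"
    using assms by (auto simp: prefix_normal_iff_balance not_le)
  have k: "0 < k" using dk by (auto intro!: Nat.gr0I simp: balance_def)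
  have d: "0 < d" using dk by (auto intro!: Nat.gr0I simp: lessThan_atLeast0)
  show thesis
  proof (cases "k \<le> d")
    case True
    \<comment> \<open>The window is already disjoint from the prefix: its length \<open>k\<close>
      takes the role of \<open>j\<close>, and its start \<open>d\<close> that of
      \<open>k\<close>.\<close>
    then show thesis using that[of k d] dk k by simp
  next
    case False
    have "{..<k} = {..<d} \<union> {d..<k}" "{d..<d + k} = {d..<k} \<union> {k..<k + d}"
      using False by auto
    then have "balance w {..<k} = balance w {..<d} + balance w {d..<k}"
      "balance w {d..<d + k} = balance w {d..<k} + balance w {k..<k + d}"
      by (simp_all add: balance_disjoint_union ivl_disj_int)
    then show thesis using that[of d k] dk d False by simp
  qed
qed

lemma num_prefix_normal_eq: "num_prefix_normal n = card {w \<in> words n. prefix_normal w}"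
  by (simp add: num_prefix_normal_def words_def)

section \<open>The lower bound\<close>

text \<open>Concave expected balance of a prefix, of order \<open>sqrt (q * j)\<close>, capped so that each letter has
  mean sign at most 1.\<close>

definition drift_sum :: "real \<Rightarrow> nat \<Rightarrow> real" where
  "drift_sum q j = min (real j) (sqrt (q * real j))"

definition drift :: "real \<Rightarrow> nat \<Rightarrow> real" where
  "drift q i = drift_sum q (Suc i) - drift_sum q i"

lemma sum_drift: "a \<le> b \<Longrightarrow> (\<Sum>i\<in>{a..<b}. drift q i) = drift_sum q b - drift_sum q a"
  unfolding drift_def by (rule sum_Suc_diff')

lemma drift_nonneg: "0 \<le> q \<Longrightarrow> 0 \<le> drift q i"
  unfolding drift_def drift_sum_def diff_ge_0_iff_ge
  by (intro min.mono real_sqrt_le_mono mult_left_mono) auto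

text \<open>\<open>drift_sum q\<close> is concave and vanishes at 0, so an increment is at most the
  average of all increments up to it. Only the scaling
  \<open>t * drift_sum q (Suc i) \<le> drift_sum q i\<close> is used, and it holds for both branches
  of the minimum.\<close>

lemma drift_le: 
  assumes "0 \<le> q"
  shows "drift q i \<le> drift_sum q (Suc i) / real (Suc i)"
proof -
  define t where "t = real i / real (Suc i)"
  have t: "0 \<le> t" "t \<le> 1" by (auto simp: t_def)
  have "t * sqrt (q * real (Suc i)) = sqrt (t\<^sup>2 * (q * real (Suc i)))"
    using t by (simp add: real_sqrt_mult)
  also have "t\<^sup>2 * (q * real (Suc i)) = t * (q * (t * real (Suc i)))"
    by (simp add: power2_eq_square)
  also have "t * real (Suc i) = real i" by (simp add: t_def)
  also have "sqrt (t * (q * real i)) \<le> sqrt (q * real i)"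
    using t assms by (simp add: mult_left_le_one_le)
  finally have "t * sqrt (q * real (Suc i)) \<le> sqrt (q * real i)" .
  moreover have "t * real (Suc i) = real i" by (simp add: t_def)
  moreover have "t * drift_sum q (Suc i) \<le> t * real (Suc i)"
    "t * drift_sum q (Suc i) \<le> t * sqrt (q * real (Suc i))"
    using t by (auto simp: drift_sum_def simp del: of_nat_Suc intro!: mult_left_mono)
  ultimately have "t * drift_sum q (Suc i) \<le> drift_sum q i"
    unfolding drift_sum_def[of q i] by simp
  moreover have "t = 1 - 1 / real (Suc i)"
    by (simp add: t_def field_simps)
  ultimately show ?thesis
    by (simp add: drift_def algebra_simps del: of_nat_Suc)
qed

lemma drift_le_1: "0 \<le> q \<Longrightarrow> drift q i \<le> 1"
  by (rule order_trans[OF drift_le]) (auto simp: drift_sum_def)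

lemma abs_drift_le_1: "0 \<le> q \<Longrightarrow> \<bar>drift q i\<bar> \<le> 1"
  using drift_nonneg[of q i] drift_le_1[of q i] by simp

lemma drift_squared_le:
  assumes "0 \<le> q"
  shows "(drift q i)\<^sup>2 \<le> q / real (Suc i)"
proof -
  have "drift q i \<le> drift_sum q (Suc i) / real (Suc i)"
    using drift_le assms .
  also have "\<dots> \<le> sqrt (q * real (Suc i)) / real (Suc i)"
    by (intro divide_right_mono) (auto simp: drift_sum_def)
  finally have "(drift q i)\<^sup>2 \<le> (sqrt (q * real (Suc i)) / real (Suc i))\<^sup>2"
    using drift_nonneg assms by (intro power_mono)
  also have "\<dots> = q / real (Suc i)"
    using assms by (simp add: power_divide power2_eq_square[of "1 + real i"])
  finally show ?thesis .
qed

text \<open>This is the exponent lost in Cauchy--Schwarz: with \<open>q\<close> of order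
  \<open>ln n\<close> it is of order \<open>(ln n)^2\<close>.\<close>

lemma sum_drift_squared_le:
  assumes "0 \<le> q"
  shows "(\<Sum>i<n. (drift q i)\<^sup>2) \<le> q * harm n"
proof -
  have "(\<Sum>i<n. (drift q i)\<^sup>2) \<le> (\<Sum>i<n. q / real (Suc i))"
    by (intro sum_mono drift_squared_le assms)
  then show ?thesis
    by (simp add: harm_altdef sum_distrib_left divide_inverse)
qed

lemma drift_eq_1:
  assumes "real (Suc i) \<le> q"
  shows "drift q i = 1"
proof -
  have "drift_sum q j = real j" if "real j \<le> q" for j
    using that mult_right_mono[OF that, of "real j"]
    by (auto simp: drift_sum_def min_def real_le_rsqrt power2_eq_square)
  then show ?thesis using assms by (simp add: drift_def)
qed

text \<open>Strong concavity of the square root: for \<open>j \<le> k\<close> the square of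
  \<open>sqrt k + sqrt j / 2\<close> is \<open>k + sqrt (k * j) + j / 4\<close>, hence at least
  \<open>k + j\<close>. So the prefix is expected to beat the window by at least
  \<open>sqrt (q * j) / 2\<close>.\<close>

lemma drift_sum_gap:
  assumes "0 \<le> q" "q < real j" "j \<le> k"
  shows "drift_sum q (k + j) - drift_sum q k - drift_sum q j \<le> - sqrt (q * real j) / 2"
proof -
  have *: "drift_sum q i = sqrt (q * real i)" if "j \<le> i" for i
  proof -
    have "q \<le> real i" using assms that by linarith
    then have "q * real i \<le> (real i)\<^sup>2"
      by (auto simp: power2_eq_square intro: mult_right_mono)
    then show ?thesis using real_sqrt_le_mono[of "q * real i" "(real i)\<^sup>2"] by (simp add: drift_sum_def)
  qed
  have "sqrt (real j) * sqrt (real j) \<le> sqrt (real j) * sqrt (real k)"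
    using assms by (intro mult_left_mono) auto
  then have "real (k + j) \<le> (sqrt (real k) + sqrt (real j) / 2)\<^sup>2"
    using assms by (simp add: power2_eq_square algebra_simps)
  then have "sqrt (real (k + j)) \<le> sqrt (real k) + sqrt (real j) / 2"
    by (intro real_le_lsqrt) auto
  then have "sqrt q * sqrt (real (k + j)) \<le> sqrt q * (sqrt (real k) + sqrt (real j) / 2)"
    using assms by (intro mult_left_mono) auto
  then show ?thesis
    using * [of j] * [of k] * [of "k + j"] assms
    by (simp only: real_sqrt_mult) (simp add: algebra_simps)
qed

section \<open>Failure probability of prefix normality under the drift\<close>

lemma sum_of_bool_mult:
  fixes x :: "nat \<Rightarrow> real"
  assumes "I \<subseteq> {..<n}"
  shows "(\<Sum>i<n. of_bool (i \<in> I) * x i) = (\<Sum>i\<in>I. x i)"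
proof -
  have "(\<Sum>i<n. of_bool (i \<in> I) * x i) = (\<Sum>i<n. if i \<in> I then x i else 0)"
    by (intro sum.cong) auto
  also have "\<dots> = (\<Sum>i\<in>{..<n} \<inter> I. x i)"
    by (rule sum.inter_restrict [symmetric]) simp
  also have "{..<n} \<inter> I = I" using assms by auto
  finally show ?thesis .
qed

lemma window_beats_prefix_prob:
  assumes "0 < q" "0 < j" "j \<le> k" "k + j \<le> n"
  shows "(\<Sum>w | w \<in> words n \<and> balance w {..<j} < balance w {k..<k + j}. word_prob (drift q) w)
    \<le> exp (- q / 16)" (is "sum _ ?A \<le> _")
proof (cases "real j \<le> q")
  case True
  \<comment> \<open>In the capped range the first \<open>j\<close> letters are 1 almost surely. No
    window of length \<open>j\<close> beats a prefix of ones, so each bad word has a 0 at a position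
    of drift 1 and gets weight 0.\<close>
  have "word_prob (drift q) w = 0" if "w \<in> ?A" for w
  proof -
    have "\<exists>i<j. \<not> w ! i"
    proof (rule ccontr)
      assume "\<not> (\<exists>i<j. \<not> w ! i)"
      then have "balance w {..<j} = real j" by (simp add: balance_def letter_sign_def)
      moreover have "balance w {k..<k + j} \<le> (\<Sum>i\<in>{k..<k + j}. 1)"
        unfolding balance_def by (intro sum_mono) (simp add: letter_sign_def)
      ultimately show False using that by simp
    qed
    then obtain i where i: "i < j" "\<not> w ! i" by blast
    then have "drift q i = 1" using True by (intro drift_eq_1) linarith
    then show ?thesis
      using i that assms unfolding word_prob_def
      by (intro prod_zero bexI[of _ i]) (auto simp: letter_sign_def words_def)
  qed
  then show ?thesis by simp
next
  case False
  \<comment> \<open>This value minimises the final exponent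
    \<open>- l * sqrt (q * j) / 2 + l^2 * j\<close>, with minimum \<open>- q / 16\<close>. The
    weight \<open>c\<close> is \<open>l\<close> on the window and \<open>- l\<close> on the prefix;
    these are disjoint since \<open>j \<le> k\<close>.\<close>
  define l where "l = sqrt (q / real j) / 4"
  define c where "c i = l * (of_bool (i \<in> {k..<k + j}) - of_bool (i \<in> {..<j}))" for i
  have sub: "{k..<k + j} \<subseteq> {..<n}" "{..<j} \<subseteq> {..<n}" using assms by auto
  have c: "(\<Sum>i<n. c i * x i) = l * ((\<Sum>i\<in>{k..<k + j}. x i) - (\<Sum>i\<in>{..<j}. x i))" for x
    unfolding c_def sum_of_bool_mult[OF sub(1), symmetric] sum_of_bool_mult[OF sub(2), symmetric]
    by (simp only: sum_subtractf [symmetric] sum_distrib_left left_diff_distrib mult.assoc)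
  have "(\<Sum>i<n. (c i)\<^sup>2) = (\<Sum>i<n. l\<^sup>2 * (of_bool (i \<in> {k..<k + j}) * 1 + of_bool (i \<in> {..<j}) * 1))"
    using assms by (intro sum.cong) (auto simp: c_def)
  also have "\<dots> = l\<^sup>2 * ((\<Sum>i\<in>{k..<k + j}. 1) + (\<Sum>i\<in>{..<j}. 1))"
    unfolding sum_of_bool_mult[OF sub(1), symmetric] sum_of_bool_mult[OF sub(2), symmetric]
    by (simp add: sum_distrib_left sum.distrib distrib_left)
  finally have c2: "(\<Sum>i<n. (c i)\<^sup>2) = 2 * l\<^sup>2 * real j" by simp
  have l: "0 \<le> l" using assms by (simp add: l_def)
  have "sum (word_prob (drift q)) ?A
      \<le> exp ((\<Sum>i<n. c i * drift q i) + (\<Sum>i<n. (c i)\<^sup>2) / 2 - 0)"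
  proof (rule chernoff_words)
    show "0 \<le> (\<Sum>i<n. c i * letter_sign (w ! i))" if "w \<in> ?A" for w
      using that l by (simp add: c balance_def)
  qed (use assms abs_drift_le_1 in auto)
  also have "(\<Sum>i<n. c i * drift q i) = l * (drift_sum q (k + j) - drift_sum q k - drift_sum q j)"
    using sum_drift[of 0 j q] sum_drift[of k "k + j" q]
    by (simp only: c lessThan_atLeast0[of j]) (simp add: drift_sum_def)
  also have "exp (l * (drift_sum q (k + j) - drift_sum q k - drift_sum q j) + (\<Sum>i<n. (c i)\<^sup>2) / 2 - 0)
      \<le> exp (l * (- sqrt (q * real j) / 2) + l\<^sup>2 * real j)"
    using mult_left_mono[OF drift_sum_gap[of q j k] l] False assms by (simp add: c2)
  also have "l * (- sqrt (q * real j) / 2) + l\<^sup>2 * real j = - q / 16"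
  proof -
    have "sqrt (q / real j) * sqrt (q * real j) = q"
      using assms by (simp add: real_sqrt_mult [symmetric])
    moreover have "l\<^sup>2 * real j = q / 16"
      using assms by (simp add: l_def power_divide)
    ultimately show ?thesis by (simp add: l_def)
  qed
  finally show ?thesis .
qed

lemma two_powr_diff: "2 powr (real n - x) = 2 ^ n * exp (- (x * ln 2))"
  by (simp add: powr_diff powr_realpow powr_def[of 2 x] exp_minus divide_inverse)

lemma sum_UNION_le:
  fixes f :: "'a \<Rightarrow> real"
  assumes "finite P" "\<And>p. p \<in> P \<Longrightarrow> finite (A p)" "\<And>x. 0 \<le> f x"
  shows "sum f (\<Union>p\<in>P. A p) \<le> (\<Sum>p\<in>P. sum f (A p))"
  using assms(1,2)
proof (induction P)
  case (insert p P)
  have "sum f (A p \<union> (\<Union>p\<in>P. A p)) \<le> sum f (A p) + sum f (\<Union>p\<in>P. A p)"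
    using insert assms(3) by (subst sum_Un) (auto intro!: sum_nonneg)
  then show ?case using insert by fastforce
qed simp

lemma not_prefix_normal_prob:
  assumes "0 < q"
  shows "(\<Sum>w | w \<in> words n \<and> \<not> prefix_normal w. word_prob (drift q) w) \<le> (real n)\<^sup>2 * exp (- q / 16)"
proof -
  define P where "P = {(j, k). 0 < j \<and> j \<le> k \<and> k + j \<le> n}"
  define A where "A = (\<lambda>(j, k). {w \<in> words n. balance w {..<j} < balance w {k..<k + j}})"
  have P: "P \<subseteq> {1..n} \<times> {1..n}" by (auto simp: P_def)
  then have finP: "finite P" by (rule finite_subset) auto
  have "card P \<le> card ({1..n} \<times> {1..n})"
    using P by (intro card_mono) auto
  then have "card P \<le> n\<^sup>2" by (simp add: power2_eq_square)
  then have cardP: "real (card P) \<le> (real n)\<^sup>2" by (simp flip: of_nat_power)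
  have "{w \<in> words n. \<not> prefix_normal w} \<subseteq> (\<Union>p\<in>P. A p)"
  proof
    fix w assume "w \<in> {w \<in> words n. \<not> prefix_normal w}"
    then have "w \<in> words n" "\<not> prefix_normal w" by auto
    then show "w \<in> (\<Union>p\<in>P. A p)"
      by (elim not_prefix_normalD) (force simp: P_def A_def words_def)
  qed
  then have "(\<Sum>w | w \<in> words n \<and> \<not> prefix_normal w. word_prob (drift q) w)
      \<le> (\<Sum>w\<in>(\<Union>p\<in>P. A p). word_prob (drift q) w)"
    using finP assms abs_drift_le_1
    by (intro sum_mono2) (auto simp: A_def intro!: word_prob_nonneg)
  also have "\<dots> \<le> (\<Sum>p\<in>P. \<Sum>w\<in>A p. word_prob (drift q) w)"
    using finP assms abs_drift_le_1
    by (intro sum_UNION_le) (auto simp: A_def intro!: word_prob_nonneg)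
  also have "\<dots> \<le> (\<Sum>p\<in>P. exp (- q / 16))"
    using window_beats_prefix_prob[OF assms]
    by (intro sum_mono) (auto simp: P_def A_def)
  also have "\<dots> = real (card P) * exp (- q / 16)" by simp
  also have "\<dots> \<le> (real n)\<^sup>2 * exp (- q / 16)"
    using cardP by (intro mult_right_mono) auto
  finally show ?thesis .
qed

section \<open>Counting prefix normal words from below\<close>

lemma num_prefix_normal_ge:
  assumes "2 \<le> n"
  shows "2 ^ n / 4 * exp (- (48 * ln (real n)) * harm n) \<le> real (num_prefix_normal n)"
proof -
  \<comment> \<open>The factor 48 turns \<open>exp (- q / 16)\<close> into \<open>1 / n^3\<close>,
    which beats the \<open>n^2\<close> pairs of the union bound.\<close>
  define q where "q = 48 * ln (real n)"
  have q: "0 < q" using assms by (simp add: q_def)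
  let ?\<mu> = "\<lambda>A. \<Sum>w\<in>A. word_prob (drift q) w"
  let ?N = "{w \<in> words n. prefix_normal w}"
  have "exp (- q / 16) = inverse (exp (of_nat 3 * ln (real n)))"
    by (simp add: q_def exp_minus)
  also have "\<dots> = inverse (real n ^ 3)"
    using assms by (subst exp_of_nat_mult) simp
  finally have "(real n)\<^sup>2 * exp (- q / 16) = 1 / real n"
    using assms by (simp add: power2_eq_square power3_eq_cube field_simps)
  also have "\<dots> \<le> 1 / 2" using assms by simp
  finally have "?\<mu> {w \<in> words n. \<not> prefix_normal w} \<le> 1 / 2"
    using not_prefix_normal_prob[OF q, of n] by linarith
  moreover have "?\<mu> ?N + ?\<mu> {w \<in> words n. \<not> prefix_normal w} = ?\<mu> (words n)"
    by (subst sum.union_disjoint [symmetric]) (auto intro!: sum.cong)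
  ultimately have "1 / 2 \<le> ?\<mu> ?N" by (simp add: sum_word_prob)
  then have "(1 / 2)\<^sup>2 \<le> (?\<mu> ?N)\<^sup>2" by (intro power_mono) auto
  then have half: "1 / 4 \<le> (?\<mu> ?N)\<^sup>2" by (simp add: power2_eq_square)
  have "2 ^ n / 4 * exp (- q * harm n) \<le> 2 ^ n * (1 / 4) * exp (- (\<Sum>i<n. (drift q i)\<^sup>2))"
    using sum_drift_squared_le[of q n] q by simp
  also have "\<dots> \<le> 2 ^ n * (?\<mu> ?N)\<^sup>2 * exp (- (\<Sum>i<n. (drift q i)\<^sup>2))"
    using half by (intro mult_right_mono mult_left_mono) auto
  also have "\<dots> \<le> real (card ?N)"
    by (rule card_ge_word_prob_squared) auto
  finally show ?thesis by (simp add: q_def num_prefix_normal_eq)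
qed

text \<open>The difference \<open>harm n - ln n\<close> decreases from its value 1 at
  \<open>n = 1\<close>.\<close>

lemma harm_le_ln:
  assumes "0 < n"
  shows "harm n \<le> 1 + ln (real n)"
  using decseqD[OF decseq_harm_diff_ln, of 0 "n - 1"] assms by (simp add: harm_expand)

lemma eventually_num_prefix_normal_ge:
  "\<forall>\<^sub>F n in sequentially.
    2 powr (real n - 200 * (ln (real n))\<^sup>2) \<le> real (num_prefix_normal n)"
proof -
  \<comment> \<open>The factor \<open>2 / 3\<close> stands in for \<open>ln 2\<close> from below;
    200 is a generous choice with \<open>200 * 2 / 3 > 48\<close>.\<close>
  have "\<forall>\<^sub>F n in sequentially.
      ln 4 + 48 * ln (real n) * (1 + ln (real n)) \<le> 200 * (ln (real n))\<^sup>2 * (2 / 3)"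
    by real_asymp
  then show ?thesis
    using eventually_ge_at_top[of 2]
  proof eventually_elim
    case (elim n)
    have "2 powr (real n - 200 * (ln (real n))\<^sup>2) = 2 ^ n * exp (- (200 * (ln (real n))\<^sup>2 * ln 2))"
      by (simp only: two_powr_diff)
    also have "\<dots> \<le> 2 ^ n * exp (- ln 4 - 48 * ln (real n) * harm n)"
    proof -
      have "48 * ln (real n) * harm n \<le> 48 * ln (real n) * (1 + ln (real n))"
        using elim harm_le_ln by (intro mult_left_mono) auto
      moreover have "200 * (ln (real n))\<^sup>2 * (2 / 3) \<le> 200 * (ln (real n))\<^sup>2 * ln 2"
        using ln2_ge_two_thirds by (intro mult_left_mono) auto
      ultimately show ?thesis using elim(1) 
        by (intro mult_left_mono) (subst exp_le_cancel_iff, linarith, simp)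
    qed
    also have "\<dots> = 2 ^ n / 4 * exp (- (48 * ln (real n)) * harm n)"
      by (simp add: exp_diff exp_minus field_simps)
    also have "\<dots> \<le> real (num_prefix_normal n)"
      using elim by (intro num_prefix_normal_ge)
    finally show ?case .
  qed
qed

section \<open>The upper bound\<close>

text \<open>Each of the \<open>q\<close> blocks is chosen from \<open>Q\<close> and the remaining
  \<open>n - q * k\<close> letters are free. Splitting off the first block changes the length, so
  \<open>n\<close> is generalised.\<close>

lemma card_words_blocks:
  assumes "Q \<subseteq> words k" "q * k \<le> n"
  shows "card {w \<in> words n. \<forall>i<q. take k (drop (i * k) w) \<in> Q} \<le> card Q ^ q * 2 ^ (n - q * k)"
  using assms(2)
proof (induction q arbitrary: n)
  case 0
  then show ?case by (simp add: card_words)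
next
  case (Suc q)
  let ?S = "\<lambda>q n. {w \<in> words n. \<forall>i<q. take k (drop (i * k) w) \<in> Q}"
  have finQ: "finite Q" using assms(1) finite_subset finite_words by blast
  have "?S (Suc q) n \<subseteq> (\<lambda>(u, v). u @ v) ` (Q \<times> ?S q (n - k))"
  proof
    fix w assume w: "w \<in> ?S (Suc q) n"
    have blocks: "take k (drop (i * k) w) \<in> Q" if "i < Suc q" for i
      using w that by simp
    have "take k w \<in> Q" using blocks[of 0] by simp
    moreover have "take k (drop (i * k) (drop k w)) \<in> Q" if "i < q" for i
      using blocks[of "Suc i"] that by (simp add: add.commute)
    then have "drop k w \<in> ?S q (n - k)" using w by (simp add: words_def)
    ultimately show "w \<in> (\<lambda>(u, v). u @ v) ` (Q \<times> ?S q (n - k))"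
      by (intro image_eqI[of _ _ "(take k w, drop k w)"]) auto
  qed
  then have "card (?S (Suc q) n) \<le> card ((\<lambda>(u, v). u @ v) ` (Q \<times> ?S q (n - k)))"
    using finQ by (intro card_mono) auto
  also have "\<dots> \<le> card (Q \<times> ?S q (n - k))"
    using finQ by (intro card_image_le) auto
  also have "\<dots> = card Q * card (?S q (n - k))"
    by (rule card_cartesian_product)
  also have "\<dots> \<le> card Q * (card Q ^ q * 2 ^ (n - k - q * k))"
    using Suc.prems by (intro mult_left_mono Suc.IH) auto
  finally show ?case by (simp add: algebra_simps)
qed

text \<open>The words of large balance are typical for the measure with constant mean sign \<open>2 * a / k\<close>.\<close>

lemma card_large_balance_ge:
  assumes "0 < a" "2 * a \<le> real k" "exp (- (a\<^sup>2 / (2 * real k))) \<le> 1 / 2"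
  shows "2 ^ k / 4 * exp (- (4 * a\<^sup>2 / real k)) \<le> real (card {u \<in> words k. a \<le> balance u {..<k}})"
proof -
  have k: "0 < real k" using assms by linarith
  define m where "m = 2 * a / real k"
  have m: "\<bar>m\<bar> \<le> 1" "real k * m = 2 * a" using assms k by (auto simp: m_def)
  define l where "l = a / real k"
  let ?\<mu> = "\<lambda>A. \<Sum>w\<in>A. word_prob (\<lambda>_. m) w"
  let ?G = "{u \<in> words k. a \<le> balance u {..<k}}"
  let ?B = "{u \<in> words k. \<not> a \<le> balance u {..<k}}"
  \<comment> \<open>The mean balance is \<open>2 * a\<close>, twice the threshold, so a word in
    \<open>?B\<close> deviates downwards by more than \<open>a\<close>. The choice
    \<open>l = a / k\<close> optimises the bound for this lower tail.\<close>
  have "?\<mu> ?B \<le> exp ((\<Sum>i<k. - l * m) + (\<Sum>i<k. (- l)\<^sup>2) / 2 - (- l * a))"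
  proof (rule chernoff_words)
    fix w assume w: "w \<in> ?B"
    have "l * balance w {..<k} \<le> l * a"
      using w assms k by (intro mult_left_mono) (auto simp: l_def)
    then show "- l * a \<le> (\<Sum>i<k. - l * letter_sign (w ! i))"
      by (simp add: balance_def sum_distrib_left sum_negf)
  qed (use m in auto)
  also have "(\<Sum>i<k. - l * m) + (\<Sum>i<k. (- l)\<^sup>2) / 2 - (- l * a) = - (a\<^sup>2 / (2 * real k))"
    using k by (simp add: l_def m_def power2_eq_square field_simps)
  finally have "?\<mu> ?B \<le> 1 / 2" using assms(3) by linarith
  moreover have "?\<mu> ?G + ?\<mu> ?B = ?\<mu> (words k)"
    by (subst sum.union_disjoint [symmetric]) (auto intro!: sum.cong)
  ultimately have "1 / 2 \<le> ?\<mu> ?G" by (simp add: sum_word_prob)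
  then have "(1 / 2)\<^sup>2 \<le> (?\<mu> ?G)\<^sup>2" by (intro power_mono) auto
  then have "2 ^ k * (1 / 4) * exp (- (\<Sum>i<k. m\<^sup>2)) \<le> 2 ^ k * (?\<mu> ?G)\<^sup>2 * exp (- (\<Sum>i<k. m\<^sup>2))"
    by (intro mult_right_mono mult_left_mono) (auto simp: power2_eq_square)
  also have "\<dots> \<le> real (card ?G)"
    by (rule card_ge_word_prob_squared) auto
  also have "(\<Sum>i<k. m\<^sup>2) = 4 * a\<^sup>2 / real k"
    using k by (simp add: m_def power2_eq_square)
  finally show ?thesis by simp
qed

text \<open>A small prefix balance forces every block of a prefix normal word to have small balance.\<close>

lemma card_small_prefix_balance_le:
  assumes "0 < a" "2 * a \<le> real k" "exp (- (a\<^sup>2 / (2 * real k))) \<le> 1 / 2"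
  shows "real (card {w \<in> words n. prefix_normal w \<and> balance w {..<k} < a})
    \<le> 2 ^ n * exp (- (exp (- (4 * a\<^sup>2 / real k)) / 4 * real (n div k)))"
proof -
  \<comment> \<open>A lower bound for the proportion of blocks with balance at least
    \<open>a\<close>. All \<open>q\<close> blocks avoid this with proportion at most
    \<open>(1 - \<rho>)^q \<le> exp (- \<rho> * q)\<close>.\<close>
  define \<rho> where "\<rho> = exp (- (4 * a\<^sup>2 / real k)) / 4"
  define Q where "Q = {u \<in> words k. \<not> a \<le> balance u {..<k}}"
  define q where "q = n div k"
  have q: "q * k \<le> n" by (simp add: q_def)
  have "card {u \<in> words k. a \<le> balance u {..<k}} + card Q = card (words k)"
    unfolding Q_def by (subst card_Un_disjoint [symmetric]) (auto intro!: arg_cong[where f = card])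
  then have "real (card {u \<in> words k. a \<le> balance u {..<k}}) + real (card Q) = 2 ^ k"
    by (simp add: card_words flip: of_nat_add)
  then have "real (card Q) \<le> 2 ^ k * (1 - \<rho>)"
    using card_large_balance_ge[OF assms] by (simp add: \<rho>_def algebra_simps)
  also have "\<dots> \<le> 2 ^ k * exp (- \<rho>)"
    using exp_ge_add_one_self[of "- \<rho>"] by (intro mult_left_mono) auto
  finally have cardQ: "real (card Q) \<le> 2 ^ k * exp (- \<rho>)" .
  have "{w \<in> words n. prefix_normal w \<and> balance w {..<k} < a}
      \<subseteq> {w \<in> words n. \<forall>i<q. take k (drop (i * k) w) \<in> Q}"
  proof safe
    fix w i assume w: "w \<in> words n" "prefix_normal w" "balance w {..<k} < a" and i: "i < q"
    have "Suc i * k \<le> q * k" using i by (intro mult_right_mono) auto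
    then have le: "i * k + k \<le> length w" using q w by (simp add: words_def)
    have "balance (take k (drop (i * k) w)) {..<k} = balance w {i * k..<i * k + k}"
      by (rule balance_take_drop[OF le])
    also have "\<dots> \<le> balance w {..<k}"
      using w(2) le by (simp add: prefix_normal_iff_balance)
    finally show "take k (drop (i * k) w) \<in> Q"
      using w(3) le by (simp add: Q_def words_def)
  qed
  then have "card {w \<in> words n. prefix_normal w \<and> balance w {..<k} < a}
      \<le> card {w \<in> words n. \<forall>i<q. take k (drop (i * k) w) \<in> Q}"
    by (intro card_mono) auto
  also have "\<dots> \<le> card Q ^ q * 2 ^ (n - q * k)"
    using q by (intro card_words_blocks) (auto simp: Q_def)
  finally have "real (card {w \<in> words n. prefix_normal w \<and> balance w {..<k} < a})
      \<le> real (card Q) ^ q * 2 ^ (n - q * k)"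
    by (auto dest: of_nat_mono[where 'a = real])
  also have "\<dots> \<le> (2 ^ k * exp (- \<rho>)) ^ q * 2 ^ (n - q * k)"
    using cardQ by (intro mult_right_mono power_mono) auto
  also have "\<dots> = 2 ^ (k * q + (n - q * k)) * exp (- \<rho>) ^ q"
    by (simp add: power_mult_distrib power_add power_mult)
  also have "k * q + (n - q * k) = n" using q by (simp add: mult.commute)
  also have "exp (- \<rho>) ^ q = exp (- (\<rho> * real q))"
    by (simp add: mult.commute flip: exp_of_nat_mult)
  finally show ?thesis by (simp add: \<rho>_def q_def)
qed

section \<open>Chernoff bound for simultaneous prefix conditions\<close>

text \<open>Summation by parts: nonincreasing weights preserve nonnegativity of partial sums. Since
  nothing is assumed on partial sums shorter than \<open>k\<close>, the weights are constant
  there.\<close>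

lemma abel_sum_nonneg:
  fixes \<mu> d :: "nat \<Rightarrow> real"
  assumes "0 < k" "k \<le> N"
    and \<mu>: "\<And>i. 0 \<le> \<mu> i" "\<And>i. \<mu> (Suc i) \<le> \<mu> i" "\<And>i. i < k \<Longrightarrow> \<mu> i = c"
    and d: "\<And>j. k \<le> j \<Longrightarrow> j \<le> N \<Longrightarrow> 0 \<le> (\<Sum>i<j. d i)"
  shows "0 \<le> (\<Sum>i<N. \<mu> i * d i)"
proof -
  \<comment> \<open>The strengthened induction claim keeps the last weight times the partial sum as
    a lower bound; \<open>j - 1\<close> is a genuine predecessor because
    \<open>0 < k \<le> j\<close>.\<close>
  have "j \<le> N \<Longrightarrow> \<mu> (j - 1) * (\<Sum>i<j. d i) \<le> (\<Sum>i<j. \<mu> i * d i)" if "k \<le> j" for j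
    using that
  proof (induction j rule: dec_induct)
    case base
    then show ?case using assms by (simp add: sum_distrib_left)
  next
    case (step j)
    have "\<mu> j * (\<Sum>i<j. d i) \<le> \<mu> (j - 1) * (\<Sum>i<j. d i)"
      using step \<mu>(2)[of "j - 1"] d[of j] assms(1) by (intro mult_right_mono) auto
    then show ?case using step by (simp add: algebra_simps)
  qed
  from this[of N] show ?thesis
    using assms(2) \<mu>(1)[of "N - 1"] d[of N] by (smt (verit) mult_nonneg_nonneg order_refl)
qed

text \<open>By summation by parts all the prefix conditions together imply a single linear
  inequality with weights \<open>\<mu>\<close>, to which the Chernoff bound for the uniform measure
  applies.\<close>

lemma card_large_prefix_balances_le:
  fixes \<mu> a :: "nat \<Rightarrow> real"
  assumes "0 < k" "k \<le> N" "N \<le> n" "a 0 = 0"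
    and \<mu>: "\<And>i. 0 \<le> \<mu> i" "\<And>i. \<mu> (Suc i) \<le> \<mu> i" "\<And>i. i < k \<Longrightarrow> \<mu> i = c"
  shows "real (card {w \<in> words n. \<forall>j\<in>{k..N}. a j \<le> balance w {..<j}})
    \<le> 2 ^ n * exp ((\<Sum>i<N. (\<mu> i)\<^sup>2) / 2 - (\<Sum>i<N. \<mu> i * (a (Suc i) - a i)))"
proof -
  let ?A = "{w \<in> words n. \<forall>j\<in>{k..N}. a j \<le> balance w {..<j}}"
  let ?t = "\<Sum>i<N. \<mu> i * (a (Suc i) - a i)"
  define l where "l i = (if i < N then \<mu> i else 0)" for i
  have l: "(\<Sum>i<n. f (l i) i) = (\<Sum>i<N. f (\<mu> i) i)" if "\<And>i. f 0 i = 0" for f :: "real \<Rightarrow> nat \<Rightarrow> real"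
    using assms(3) that by (intro sum.mono_neutral_cong_right) (auto simp: l_def)
  have "real (card ?A) / 2 ^ n = (\<Sum>w\<in>?A. word_prob (\<lambda>_. 0) w)"
    by (simp add: word_prob_zero words_def)
  also have "\<dots> \<le> exp ((\<Sum>i<n. l i * 0) + (\<Sum>i<n. (l i)\<^sup>2) / 2 - ?t)"
  proof (rule chernoff_words)
    fix w assume w: "w \<in> ?A"
    have "0 \<le> (\<Sum>i<N. \<mu> i * (letter_sign (w ! i) - (a (Suc i) - a i)))"
    proof (rule abel_sum_nonneg[where c = c, OF assms(1,2)])
      fix j assume "k \<le> j" "j \<le> N"
      then show "0 \<le> (\<Sum>i<j. letter_sign (w ! i) - (a (Suc i) - a i))"
        using w assms(4) unfolding sum_subtractf[of "\<lambda>i. letter_sign (w ! i)"]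
        by (simp add: sum_lessThan_telescope balance_def)
    qed (use \<mu> in auto)
    then show "?t \<le> (\<Sum>i<n. l i * letter_sign (w ! i))"
      using l[of "\<lambda>x i. x * letter_sign (w ! i)"]
      by (simp add: right_diff_distrib sum_subtractf)
  qed auto
  also have "(\<Sum>i<n. (l i)\<^sup>2) = (\<Sum>i<N. (\<mu> i)\<^sup>2)"
    using l[of "\<lambda>x i. x\<^sup>2"] by simp
  finally show ?thesis by (simp add: field_simps)
qed

text \<open>Telescoping of \<open>ln (i + 2) - ln (i + 1) \<le> 1 / (i + 1)\<close>.\<close>

lemma sum_inverse_ge_ln:
  assumes "k \<le> N"
  shows "ln (real (Suc N)) - ln (real (Suc k)) \<le> (\<Sum>i\<in>{k..<N}. 1 / real (Suc i))"
proof -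
  have "ln (real (Suc N)) - ln (real (Suc k)) = (\<Sum>i\<in>{k..<N}. ln (real (Suc (Suc i))) - ln (real (Suc i)))"
    using sum_Suc_diff'[OF assms, of "\<lambda>i. ln (real (Suc i))"] by simp
  also have "\<dots> \<le> (\<Sum>i\<in>{k..<N}. 1 / real (Suc i))"
  proof (rule sum_mono)
    fix i
    show "ln (real (Suc (Suc i))) - ln (real (Suc i)) \<le> 1 / real (Suc i)"
      using ln_diff_le[of "real (Suc (Suc i))" "real (Suc i)"] by simp
  qed
  finally show ?thesis .
qed

lemma sqrt_Suc_diff_ge: "1 / (2 * sqrt (real (Suc i))) \<le> sqrt (real (Suc i)) - sqrt (real i)"
proof -
  have "0 \<le> (sqrt (real (Suc i)) - sqrt (real i))\<^sup>2" by simp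
  then have "1 \<le> 2 * sqrt (real (Suc i)) * (sqrt (real (Suc i)) - sqrt (real i))"
    by (simp add: power2_eq_square algebra_simps)
  then show ?thesis by (simp add: field_simps)
qed

lemma card_sqrt_prefix_balances_le:
  assumes "0 < k" "k \<le> N" "N \<le> n" "0 \<le> L"
  shows "real (card {w \<in> words n. \<forall>j\<in>{k..N}. sqrt (real j * L) / 4 \<le> balance w {..<j}})
    \<le> 2 ^ n * exp (L / 128 * (1 - (\<Sum>i\<in>{k..<N}. 1 / real (Suc i))))"
proof -
  define \<mu> where "\<mu> i = sqrt L / (8 * sqrt (real (max (Suc i) k)))" for i
  define a where "a j = sqrt (real j * L) / 4" for j
  let ?H = "\<Sum>i\<in>{k..<N}. 1 / real (Suc i)"
  have "{..<N} = {..<k} \<union> {k..<N}" using assms by auto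
  then have split: "(\<Sum>i<N. f i) = (\<Sum>i<k. f i) + (\<Sum>i\<in>{k..<N}. f i)" for f :: "nat \<Rightarrow> real"
    by (simp add: sum.union_disjoint ivl_disj_int)
  have \<mu>_nonneg: "0 \<le> \<mu> i" for i using assms by (simp add: \<mu>_def)
  have "(\<Sum>i<k. (\<mu> i)\<^sup>2) = (\<Sum>i<k. L / (64 * real k))"
    using assms by (intro sum.cong) (auto simp: \<mu>_def power_divide power_mult_distrib max_def)
  moreover have "(\<Sum>i\<in>{k..<N}. (\<mu> i)\<^sup>2) = (\<Sum>i\<in>{k..<N}. L / 64 * (1 / real (Suc i)))"
    using assms by (intro sum.cong) (auto simp: \<mu>_def power_divide power_mult_distrib max_def)
  ultimately have sq: "(\<Sum>i<N. (\<mu> i)\<^sup>2) = L / 64 + L / 64 * ?H"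
    using assms by (simp add: split sum_distrib_left)
  have diff: "sqrt L / (8 * sqrt (real (Suc i))) \<le> a (Suc i) - a i" for i
  proof -
    have "sqrt L / 4 * (1 / (2 * sqrt (real (Suc i)))) \<le> sqrt L / 4 * (sqrt (real (Suc i)) - sqrt (real i))"
      using assms by (intro mult_left_mono sqrt_Suc_diff_ge) auto
    then show ?thesis by (simp add: a_def real_sqrt_mult right_diff_distrib diff_divide_distrib mult.commute)
  qed
  have "L / 64 * ?H = (\<Sum>i\<in>{k..<N}. \<mu> i * (sqrt L / (8 * sqrt (real (Suc i)))))"
    unfolding sum_distrib_left
    using assms by (intro sum.cong) (auto simp: \<mu>_def max_def)
  also have "\<dots> \<le> (\<Sum>i\<in>{k..<N}. \<mu> i * (a (Suc i) - a i))"
    by (intro sum_mono mult_left_mono diff \<mu>_nonneg)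
  also have "\<dots> \<le> (\<Sum>i<N. \<mu> i * (a (Suc i) - a i))"
  proof -
    have "0 \<le> a (Suc i) - a i" for i
      using assms by (auto simp: a_def intro!: divide_right_mono mult_right_mono)
    then show ?thesis unfolding split using \<mu>_nonneg by (simp add: sum_nonneg)
  qed
  finally have lin: "L / 64 * ?H \<le> (\<Sum>i<N. \<mu> i * (a (Suc i) - a i))" .
  have "real (card {w \<in> words n. \<forall>j\<in>{k..N}. a j \<le> balance w {..<j}})
      \<le> 2 ^ n * exp ((\<Sum>i<N. (\<mu> i)\<^sup>2) / 2 - (\<Sum>i<N. \<mu> i * (a (Suc i) - a i)))"
  proof (rule card_large_prefix_balances_le[OF assms(1-3)])
    show "\<mu> (Suc i) \<le> \<mu> i" for i
      unfolding \<mu>_def using assms by (intro divide_left_mono mult_left_mono) auto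
    show "\<mu> i = sqrt L / (8 * sqrt (real k))" if "i < k" for i
      using that by (simp add: \<mu>_def max_def)
  qed (auto simp: a_def \<mu>_nonneg)
  also have "\<dots> \<le> 2 ^ n * exp (L / 128 * (1 - ?H))"
  proof -
    have "L / 128 * (1 - ?H) = L / 64 / 2 - L / 64 * ?H / 2" by (simp add: algebra_simps)
    then have "(\<Sum>i<N. (\<mu> i)\<^sup>2) / 2 - (\<Sum>i<N. \<mu> i * (a (Suc i) - a i)) \<le> L / 128 * (1 - ?H)"
      using lin sq by linarith
    then show ?thesis by simp
  qed
  finally show ?thesis by (simp add: a_def)
qed

section \<open>Assembling the upper bound\<close>

text \<open>The first summand covers the words with a small balance at some length \<open>j\<close>
  between about \<open>n^(1/4)\<close> and \<open>sqrt n\<close>, by a union bound over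
  \<open>j\<close>. The second covers the words whose balance is large at all these lengths.\<close>

lemma num_prefix_normal_le:
  assumes n: "0 < n" and "16 \<le> ln (real n)" "ln (real n) \<le> 4 * real n powr (1 / 4)"
    "real n powr (1 / 4) + 2 \<le> sqrt (real n)"
    "exp (- (ln (real n) / 32)) \<le> 1 / 2"
  shows "real (num_prefix_normal n) \<le> 2 ^ n *
    (real n * exp (- (exp (- (ln (real n) / 4)) / 4 * (sqrt (real n) - 1))) +
     exp (ln (real n) / 128 * (3 - ln (real n) / 4)))"
proof -
  define L where "L = ln (real n)"
  \<comment> \<open>The harmonic sum from \<open>k\<close> to \<open>N\<close> is about
    \<open>ln n / 4\<close>, while lengths up to \<open>N\<close> still leave about
    \<open>sqrt n\<close> disjoint blocks or more.\<close>
  define k where "k = nat \<lceil>real n powr (1 / 4)\<rceil>"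
  define N where "N = nat \<lfloor>sqrt (real n)\<rfloor>"
  define B where "B j = {w \<in> words n. prefix_normal w \<and> balance w {..<j} < sqrt (real j * L) / 4}" for j
  let ?D = "{w \<in> words n. \<forall>j\<in>{k..N}. sqrt (real j * L) / 4 \<le> balance w {..<j}}"
  let ?e = "exp (- (exp (- (L / 4)) / 4 * (sqrt (real n) - 1)))"
  have L: "16 \<le> L" using assms by (simp add: L_def)
  have k: "real n powr (1 / 4) \<le> real k" "real k \<le> real n powr (1 / 4) + 1"
    using of_nat_nat[of "\<lceil>real n powr (1 / 4)\<rceil>"] unfolding k_def
    by (simp_all add: of_nat_ceiling)
  have N: "real N \<le> sqrt (real n)" "sqrt (real n) \<le> real N + 1"
    using real_sqrt_ge_zero[of "real n"] unfolding N_def by linarith+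
  have "0 < real n powr (1 / 4)" using n by simp
  then have k0: "0 < k" using k(1) by linarith
  have kN: "k \<le> N" using k N assms by linarith
  have "sqrt (real n) \<le> sqrt ((real n)\<^sup>2)"
    using n by (intro real_sqrt_le_mono) (simp add: power2_eq_square)
  then have Nn: "N \<le> n" using N by simp
  have B: "real (card (B j)) \<le> 2 ^ n * ?e" if j: "j \<in> {k..N}" for j
  proof -
    \<comment> \<open>With this threshold \<open>4 * a^2 / j\<close> is \<open>L / 4\<close>, so a
      block is large with proportion at least \<open>n^(-1/4) / 4\<close>, far more than one over
      the number of blocks.\<close>
    define a where "a = sqrt (real j * L) / 4"
    have j0: "0 < real j" using j k0 by auto
    have a2: "a\<^sup>2 = real j * L / 16" using j0 L by (simp add: a_def power_divide)
    have "L \<le> 4 * real j" using assms j k by (simp add: L_def) 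
    then have "real j * L \<le> (2 * real j)\<^sup>2"
      using j0 by (simp add: power2_eq_square)
    then have "sqrt (real j * L) \<le> 2 * real j" by (intro real_le_lsqrt) (use j0 L in auto)
    then have "2 * a \<le> real j" by (simp add: a_def)
    moreover have "exp (- (a\<^sup>2 / (2 * real j))) \<le> 1 / 2"
      using assms j0 by (simp add: a2 L_def)
    moreover have "0 < a" using j0 L by (simp add: a_def)
    ultimately have "real (card (B j)) \<le> 2 ^ n * exp (- (exp (- (4 * a\<^sup>2 / real j)) / 4 * real (n div j)))"
      unfolding B_def a_def [symmetric] by (intro card_small_prefix_balance_le)
    also have "4 * a\<^sup>2 / real j = L / 4" using j0 by (simp add: a2)
    also have "2 ^ n * exp (- (exp (- (L / 4)) / 4 * real (n div j))) \<le> 2 ^ n * ?e"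
    proof -
      have "real j \<le> sqrt (real n)" using j N by auto
      then have "sqrt (real n) * real j \<le> sqrt (real n) * sqrt (real n)"
        by (intro mult_left_mono) auto
      then have "sqrt (real n) \<le> real n / real j" using j0 by (simp add: field_simps)
      also have "real n / real j \<le> real (n div j) + 1"
      proof -
        have "n \<le> (n div j + 1) * j"
          using dividend_less_div_times[of j n] j0 by (simp add: algebra_simps)
        then have "real n \<le> real ((n div j + 1) * j)" by (rule of_nat_mono)
        then show ?thesis using j0 by (simp add: divide_le_eq algebra_simps)
      qed
      finally have "exp (- (L / 4)) / 4 * (sqrt (real n) - 1) \<le> exp (- (L / 4)) / 4 * real (n div j)"
        by (intro mult_left_mono) auto
      then show ?thesis by simp
    qed
    finally show ?thesis .
  qed
  have "real (card ?D) \<le> 2 ^ n * exp (L / 128 * (1 - (\<Sum>i\<in>{k..<N}. 1 / real (Suc i))))"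
    using k0 kN Nn L by (intro card_sqrt_prefix_balances_le) auto
  also have "\<dots> \<le> 2 ^ n * exp (L / 128 * (3 - L / 4))"
  proof -
    have "L / 2 = ln (sqrt (real n))" using n by (simp add: L_def ln_sqrt)
    also have "\<dots> \<le> ln (real (Suc N))" using N n by (subst ln_le_cancel_iff) auto
    finally have 1: "L / 2 \<le> ln (real (Suc N))" .
    have "1 \<le> real n powr (1 / 4)" using n by (simp add: ge_one_powr_ge_zero)
    then have "real (Suc k) \<le> 3 * real n powr (1 / 4)" using k by simp
    then have "ln (real (Suc k)) \<le> ln (3 * real n powr (1 / 4))"
      using n by (subst ln_le_cancel_iff) auto
    also have "\<dots> = ln 3 + L / 4" using n by (simp add: ln_mult ln_powr L_def)
    also have "ln (3::real) \<le> 2" using ln_le_minus_one[of "3::real"] by simp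
    finally have "L / 4 - 2 \<le> (\<Sum>i\<in>{k..<N}. 1 / real (Suc i))"
      using 1 sum_inverse_ge_ln[OF kN] by linarith
    then show ?thesis using L by (intro mult_left_mono iffD2[OF exp_le_cancel_iff]) auto
  qed
  finally have D: "real (card ?D) \<le> 2 ^ n * exp (L / 128 * (3 - L / 4))" .
  have "{w \<in> words n. prefix_normal w} \<subseteq> (\<Union>j\<in>{k..N}. B j) \<union> ?D"
    by (auto simp: B_def not_le)
  then have "card {w \<in> words n. prefix_normal w} \<le> card ((\<Union>j\<in>{k..N}. B j) \<union> ?D)"
    by (intro card_mono) (auto simp: B_def)
  also have "\<dots> \<le> card (\<Union>j\<in>{k..N}. B j) + card ?D"
    by (rule card_Un_le)
  also have "card (\<Union>j\<in>{k..N}. B j) \<le> (\<Sum>j\<in>{k..N}. card (B j))"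
    by (rule card_UN_le) simp
  finally have "real (num_prefix_normal n) \<le> (\<Sum>j\<in>{k..N}. real (card (B j))) + real (card ?D)"
    by (simp add: num_prefix_normal_eq flip: of_nat_sum of_nat_add)
  also have "\<dots> \<le> (\<Sum>j\<in>{k..N}. 2 ^ n * ?e) + 2 ^ n * exp (L / 128 * (3 - L / 4))"
    by (intro add_mono sum_mono B D)
  also have "(\<Sum>j\<in>{k..N}. 2 ^ n * ?e) \<le> real n * (2 ^ n * ?e)"
  proof -
    have "real (card {k..N}) \<le> real n" using k0 Nn by simp
    then show ?thesis by (simp only: sum_constant) (intro mult_right_mono, auto)
  qed
  finally show ?thesis by (simp add: L_def algebra_simps)
qed

lemma eventually_num_prefix_normal_le:
  "\<forall>\<^sub>F n in sequentially.
    real (num_prefix_normal n) \<le> 2 powr (real n - 1 / 1024 * (ln (real n))\<^sup>2)"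
proof -
  have "\<forall>\<^sub>F n in sequentially. 16 \<le> ln (real n)"
    "\<forall>\<^sub>F n in sequentially. ln (real n) \<le> 4 * real n powr (1 / 4)"
    "\<forall>\<^sub>F n in sequentially. real n powr (1 / 4) + 2 \<le> sqrt (real n)"
    "\<forall>\<^sub>F n in sequentially. exp (- (ln (real n) / 32)) \<le> 1 / 2"
    \<comment> \<open>The block term decays like an exponential of \<open>- n^(1/4) / 4\<close>. In
      the next condition the leading coefficient is \<open>- 1 / 512\<close>, so
      \<open>1 / 1024\<close> leaves room for the lower-order terms.\<close>
    "\<forall>\<^sub>F n in sequentially.
      real n * exp (- (exp (- (ln (real n) / 4)) / 4 * (sqrt (real n) - 1)))
      \<le> exp (- (1 / 1024 * (ln (real n))\<^sup>2)) / 2"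
    "\<forall>\<^sub>F n in sequentially.
      ln (real n) / 128 * (3 - ln (real n) / 4) \<le> - (1 / 1024 * (ln (real n))\<^sup>2) - ln 2"
    by real_asymp+
  then show ?thesis
    using eventually_gt_at_top[of 0]
  proof eventually_elim
    case (elim n)
    have "exp (ln (real n) / 128 * (3 - ln (real n) / 4)) \<le> exp (- (1 / 1024 * (ln (real n))\<^sup>2) - ln 2)"
      using elim(6) by (rule iffD2[OF exp_le_cancel_iff])
    also have "\<dots> = exp (- (1 / 1024 * (ln (real n))\<^sup>2)) / 2"
      by (simp add: exp_diff)
    finally have "exp (ln (real n) / 128 * (3 - ln (real n) / 4)) \<le> exp (- (1 / 1024 * (ln (real n))\<^sup>2)) / 2" .
    then have "2 ^ n * (real n * exp (- (exp (- (ln (real n) / 4)) / 4 * (sqrt (real n) - 1))) +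
        exp (ln (real n) / 128 * (3 - ln (real n) / 4)))
      \<le> 2 ^ n * exp (- (1 / 1024 * (ln (real n))\<^sup>2))"
      using elim(5) by (intro mult_left_mono) auto
    with num_prefix_normal_le[OF elim(7,1-4)]
    have "real (num_prefix_normal n) \<le> 2 ^ n * exp (- (1 / 1024 * (ln (real n))\<^sup>2))"
      by linarith
    \<comment> \<open>Passing to base 2 only weakens the bound, as
      \<open>ln 2 \<le> 1\<close>.\<close>
    also have "\<dots> \<le> 2 ^ n * exp (- (1 / 1024 * (ln (real n))\<^sup>2 * ln 2))"
      using ln_le_minus_one[of "2::real"] by (simp add: mult_left_le)
    also have "\<dots> = 2 powr (real n - 1 / 1024 * (ln (real n))\<^sup>2)"
      by (simp only: two_powr_diff)
    finally show ?case .
  qed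
qed

theorem theorem1:
  shows "\<exists>c1 c2 :: real. 0 < c1 \<and> c1 \<le> c2 \<and>
    (\<forall>\<^sub>F n :: nat in sequentially.
       2 powr (real n - c2 * (ln (real n))\<^sup>2) \<le> real (num_prefix_normal n) \<and>
       real (num_prefix_normal n) \<le> 2 powr (real n - c1 * (ln (real n))\<^sup>2))"
proof (intro exI conjI)
  show "\<forall>\<^sub>F n in sequentially.
      2 powr (real n - 200 * (ln (real n))\<^sup>2) \<le> real (num_prefix_normal n) \<and>
      real (num_prefix_normal n) \<le> 2 powr (real n - 1 / 1024 * (ln (real n))\<^sup>2)"
    using eventually_num_prefix_normal_ge eventually_num_prefix_normal_le by (rule eventually_conj)
qed auto

end
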